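(* Let $\mathcal{A}=\{A_1,\dots,A_m\}$ be a finite family of nonnegative $d\times d$ matrices with probabilities $p_1,\dots,p_m$, satisfying the two conditions: (a) there is at least one product of matrices from $\mathcal{A}$ (with repetitions permitted) all of whose entries are strictly positive; (b) no matrix from $\mathcal{A}$ has a zero row or a zero column. Let $\lambda$ be the Lyapunov exponent of $\mathcal{A}$. Then for all vectors $x,v\in\mathbb{R}^d$ with strictly positive entries we have $$\beta_k(v)\ \le\ \lambda\ \le\ \alpha_k(x)\qquad\text{for all }k\in\mathbb{N},$$ and there is a constant $C$ depending on $\mathcal{A}$, $x$ and $v$ such that $$\alpha_k(x)-\beta_k(v)\ \le\ C\,k^{-1}\qquad\text{for all }k\in\mathbb{N}.$$
   Context: $p_j>0$, $\sum_{j=1}^m p_j=1$. For $k\in\mathbb{N}$ ($k\ge1$), $\mathcal{A}^k$ is the family of all $m^k$ products of length $k$ with the product probabilities, and $\mathbf{E}\{g(B)\mid B\in\mathcal{A}^k\}=\sum_{d_1,\dots,d_k}p_{d_1}\cdots p_{d_k}\,g(A_{d_k}\cdots A_{d_1})$. The Lyapunov exponent is $\lambda=\lim_{k\to\infty}\frac1k\mathbf{E}\{\log\|B\|\mid B\in\mathcal{A}^k\}$. For $x,v$ with strictly positive entries: $$\alpha_k(x)=\frac1k\,\mathbf{E}\Bigl\{\log\max_{i=1,\dots,d}\frac{(Bx)_i}{x_i}\ \Big|\ B\in\mathcal{A}^k\Bigr\},$$ $$\beta_k(v)=\frac1k\min_{j=1,\dots,d}\Bigl(-\log v_j+\mathbf{E}\bigl\{\log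 (v,b^j)\mid B\in\mathcal{A}^k\bigr\}\Bigr),$$ where $b^j$ denotes the $j$th column of $B$ and $(\cdot,\cdot)$ is the standard inner product. *)

theory Defs
  imports "HOL-Analysis.Analysis"
begin

definition words :: "nat \<Rightarrow> nat \<Rightarrow> nat list set" where
  "words m k = {w. set w \<subseteq> {1..m} \<and> length w = k}"

text \<open>The word \<open>[d1, ..., dk]\<close> is sent to \<open>A dk ** ... ** A d1\<close>: later letters multiply on the left.\<close>

definition word_prod :: "(nat \<Rightarrow> real^'n^'n) \<Rightarrow> nat list \<Rightarrow> real^'n^'n" where
  "word_prod A w = fold (\<lambda>l B. A l ** B) w (mat 1)"

definition prod_expectation ::
  "nat \<Rightarrow> (nat \<Rightarrow> real^'n^'n) \<Rightarrow> (nat \<Rightarrow> real) \<Rightarrow> nat \<Rightarrow> (real^'n^'n \<Rightarrow> real) \<Rightarrow> real" where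
  "prod_expectation m A p k g = (\<Sum>w\<in>words m k. prod_list (map p w) * g (word_prod A w))"

text \<open>The value does not depend on the choice of the matrix norm, by equivalence of norms in
  finite dimension; the Euclidean operator norm is used.\<close>

definition lyapunov_exponent ::
  "nat \<Rightarrow> (nat \<Rightarrow> real^'n^'n) \<Rightarrow> (nat \<Rightarrow> real) \<Rightarrow> real" where
  "lyapunov_exponent m A p =
     lim (\<lambda>k. (1 / real k) * prod_expectation m A p k (\<lambda>B. ln (onorm ((*v) B))))"

definition lyap_alpha ::
  "nat \<Rightarrow> (nat \<Rightarrow> real^'n^'n) \<Rightarrow> (nat \<Rightarrow> real) \<Rightarrow> nat \<Rightarrow> real^'n \<Rightarrow> real" where
  "lyap_alpha m A p k x =
     (1 / real k) * prod_expectation m A p k (\<lambda>B. ln (MAX i. (B *v x) $ i / x $ i))"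

definition lyap_beta ::
  "nat \<Rightarrow> (nat \<Rightarrow> real^'n^'n) \<Rightarrow> (nat \<Rightarrow> real) \<Rightarrow> nat \<Rightarrow> real^'n \<Rightarrow> real" where
  "lyap_beta m A p k v =
     (1 / real k) * (MIN j. - ln (v $ j) + prod_expectation m A p k (\<lambda>B. ln (v \<bullet> column j B)))"

end

theory Submission
  imports Defs
begin

text \<open>
  The expectations \<open>a k = k * alpha k x\<close> are subadditive, because \<open>max (B x)_i / x_i\<close> is
  submultiplicative, and \<open>b k = k * beta k v\<close> is superadditive, by concavity of the logarithm.
  Everything therefore reduces to \<open>a k - b k\<close> being bounded, that is, to a uniform bound on the
  expected logarithm of the ratio between the norm of a product and the norm of one of its columns.
  This ratio changes by a bounded factor with each letter, and it is reset to a bounded value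
  whenever the positive word occurs; as that word occurs with probability \<open>q > 0\<close> in each block,
  the expectation stays bounded.
\<close>

section \<open>Limits of subadditive and superadditive sequences at bounded distance\<close>

text \<open>A two-sided Fekete lemma. The bound \<open>ba\<close> keeps every quotient of
  \<open>b\<close> below every quotient of \<open>a\<close>, so the infimum of the latter lies
  between the two families; \<open>ab\<close> then turns this into convergence at rate
  \<open>D / k\<close>.\<close>

lemma subadditive_superadditive_limit:
  fixes a b :: "nat \<Rightarrow> real"
  assumes sub: "\<And>k l. a (k + l) \<le> a k + a l"
    and super: "\<And>k l. b k + b l \<le> b (k + l)"
    and ba: "\<And>k. b k \<le> a k + C"
    and ab: "\<And>k. a k \<le> b k + D"
  obtains L where "(\<lambda>k. a k / real k) \<longlonglongrightarrow> L"
    and "\<And>k. k \<ge> 1 \<Longrightarrow> b k / real k \<le> L" and "\<And>k. k \<ge> 1 \<Longrightarrow> L \<le> a k / real k"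
proof -
  \<comment> \<open>The count starts at \<open>Suc n\<close> because a subadditive \<open>a\<close>
    may have \<open>a 0 > 0\<close>, and then the bound fails for zero summands; likewise
    \<open>b 0\<close> may be negative.\<close>
  have sub_mult: "a (Suc n * k) \<le> real (Suc n) * a k" for n k
  proof (induction n)
    case (Suc n)
    have "a (Suc (Suc n) * k) \<le> a k + a (Suc n * k)"
      using sub[of k "Suc n * k"] by simp
    then show ?case using Suc by (simp add: algebra_simps)
  qed simp
  have super_mult: "real (Suc n) * b k \<le> b (Suc n * k)" for n k
  proof (induction n)
    case (Suc n)
    have "b k + b (Suc n * k) \<le> b (Suc (Suc n) * k)"
      using super[of k "Suc n * k"] by simp
    then show ?case using Suc by (simp add: algebra_simps)
  qed simp
  have quot_le: "b k / real k \<le> a l / real l" if kl: "k \<ge> 1" "l \<ge> 1" for k l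
  proof -
    \<comment> \<open>Both sequences are compared at the common index \<open>Suc n * l * k\<close>.
      The additive error \<open>C\<close> is divided by this index and vanishes as \<open>n\<close>
      grows.\<close>
    have *: "b k / real k - a l / real l \<le> (C / (real k * real l)) / real (Suc n)" for n
    proof -
      define N where "N = Suc n"
      have N: "N > 0" by (simp add: N_def)
      have "real (N * l) * b k \<le> b (N * l * k)"
        using super_mult[of "N * l - 1" k] N kl by (simp del: of_nat_Suc)
      also have "\<dots> \<le> a (N * l * k) + C" by (rule ba)
      also have "a (N * l * k) \<le> real (N * k) * a l"
        using sub_mult[of "N * k - 1" l] N kl by (simp add: mult_ac del: of_nat_Suc)
      finally have "real (N * l) * b k \<le> real (N * k) * a l + C" by simp
      then have "real (N * l) * b k / real (N * k * l) \<le> (real (N * k) * a l + C) / real (N * k * l)"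
        by (rule divide_right_mono) simp
      then show ?thesis
        unfolding N_def[symmetric] using N kl by (simp add: add_divide_distrib mult_ac)
    qed
    have "(\<lambda>n. (C / (real k * real l)) / real (Suc n)) \<longlonglongrightarrow> 0"
      by (rule LIMSEQ_Suc[OF lim_const_over_n])
    then have "b k / real k - a l / real l \<le> 0"
      by (rule LIMSEQ_le_const) (use * in blast)
    then show ?thesis by simp
  qed
  define L where "L = (INF l\<in>{1..}. a l / real l)"
  have low: "b k / real k \<le> L" if "k \<ge> 1" for k
    unfolding L_def by (rule cINF_greatest) (use quot_le[OF that] in auto)
  \<comment> \<open>The family must be bounded below for its infimum to be a lower bound;
    \<open>quot_le\<close> at index 1 supplies the bound \<open>b 1\<close>.\<close>
  have up: "L \<le> a k / real k" if "k \<ge> 1" for k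
    unfolding L_def
    by (rule cINF_lower) (use quot_le[of 1] that in \<open>auto intro!: bdd_belowI2[of _ "b 1"]\<close>)
  have "(\<lambda>k. a k / real k - L) \<longlonglongrightarrow> 0"
  proof (rule real_tendsto_sandwich)
    show "\<forall>\<^sub>F k in sequentially. 0 \<le> a k / real k - L"
      using eventually_ge_at_top[of 1] by eventually_elim (use up in force)
    show "\<forall>\<^sub>F k in sequentially. a k / real k - L \<le> D / real k"
      using eventually_ge_at_top[of 1]
    proof eventually_elim
      case (elim k)
      then have "a k / real k \<le> b k / real k + D / real k"
        using ab[of k] by (simp add: divide_right_mono flip: add_divide_distrib)
      with low[OF elim] show ?case by simp
    qed
  qed (auto intro: lim_const_over_n)
  then have "(\<lambda>k. a k / real k) \<longlonglongrightarrow> L" by (simp add: LIM_zero_iff)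
  then show thesis using low up that by blast
qed

section \<open>Nonnegative matrices without zero columns\<close>

text \<open>On nonnegative vectors this is the l1 norm, but it is linear, so the total of a matrix
  image can be computed exactly.\<close>

definition coord_sum :: "real^'n \<Rightarrow> real" where
  "coord_sum u = (\<Sum>i\<in>UNIV. u $ i)"

text \<open>The working substitute for the operator norm: equivalent to it on nonnegative matrices,
  and easy to compare with column sums.\<close>

definition entry_sum :: "real^'n^'n \<Rightarrow> real" where
  "entry_sum B = (\<Sum>i\<in>UNIV. \<Sum>j\<in>UNIV. B $ i $ j)"

text \<open>The class contains the identity and is closed under products, so it covers the products
  of all words, the empty one included. The second clause keeps a nonzero nonnegative vector from
  being sent to zero.\<close>

definition column_allowable :: "real^'n^'n \<Rightarrow> bool" where
  "column_allowable B \<longleftrightarrow> (\<forall>i j. 0 \<le> B $ i $ j) \<and> (\<forall>j. \<exists>i. 0 < B $ i $ j)"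

lemma column_allowable_nonneg: "column_allowable B \<Longrightarrow> 0 \<le> B $ i $ j"
  by (simp add: column_allowable_def)

lemma coord_sum_mult_vec: "coord_sum (B *v u) = (\<Sum>j\<in>UNIV. (\<Sum>i\<in>UNIV. B $ i $ j) * u $ j)"
  unfolding coord_sum_def matrix_vector_mult_def
  by (simp add: sum_distrib_right) (rule sum.swap)

lemma entry_sum_eq_coord_sum: "entry_sum B = coord_sum (B *v 1)"
  by (simp add: entry_sum_def coord_sum_def matrix_vector_mult_def)

lemma column_allowable_mat_1: "column_allowable (mat 1)"
  by (auto simp: column_allowable_def mat_def)

lemma column_allowable_mult:
  assumes "column_allowable B" "column_allowable B'"
  shows "column_allowable (B ** B')"
  unfolding column_allowable_def
proof (intro conjI allI)
  show "0 \<le> (B ** B') $ i $ j" for i j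
    using assms by (simp add: matrix_matrix_mult_def column_allowable_nonneg sum_nonneg)
  show "\<exists>i. 0 < (B ** B') $ i $ j" for j
  proof -
    obtain l where l: "0 < B' $ l $ j" using assms unfolding column_allowable_def by blast
    obtain i where i: "0 < B $ i $ l" using assms unfolding column_allowable_def by blast
    have "0 < (\<Sum>k\<in>UNIV. B $ i $ k * B' $ k $ j)"
      by (rule sum_pos2[of _ l]) (use assms i l in \<open>auto simp: column_allowable_nonneg\<close>)
    then show ?thesis by (auto simp: matrix_matrix_mult_def)
  qed
qed

lemma column_sum_pos:
  assumes "column_allowable B"
  shows "0 < (\<Sum>i\<in>UNIV. B $ i $ j)"
proof -
  obtain i where "0 < B $ i $ j" using assms unfolding column_allowable_def by blast
  then show ?thesis
    by (intro sum_pos2[of _ i]) (use assms in \<open>auto simp: column_allowable_nonneg\<close>)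
qed

lemma entry_sum_pos: "column_allowable B \<Longrightarrow> 0 < entry_sum B"
  unfolding entry_sum_def by (subst sum.swap) (auto intro: sum_pos column_sum_pos)

lemma mult_vec_nonneg:
  assumes "column_allowable B" "\<And>i. 0 \<le> u $ i"
  shows "0 \<le> (B *v u) $ i"
  using assms by (simp add: matrix_vector_mult_def column_allowable_nonneg sum_nonneg)

lemma mult_vec_mono:
  assumes "column_allowable B" "\<And>i. u $ i \<le> w $ i"
  shows "(B *v u) $ i \<le> (B *v w) $ i"
  using assms by (auto simp: matrix_vector_mult_def column_allowable_nonneg intro!: sum_mono mult_left_mono)

lemma coord_sum_mono: "(\<And>i. u $ i \<le> w $ i) \<Longrightarrow> coord_sum u \<le> coord_sum w"
  by (simp add: coord_sum_def sum_mono)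

lemma coord_sum_scale: "coord_sum (c *s u) = c * coord_sum u"
  by (simp add: coord_sum_def sum_distrib_left)

lemma component_le_coord_sum: "(\<And>i. 0 \<le> u $ i) \<Longrightarrow> u $ i \<le> coord_sum u"
  unfolding coord_sum_def by (rule member_le_sum) auto

text \<open>Each coordinate of \<open>u\<close> is at most the total, so \<open>u\<close> lies below
  \<open>coord_sum u *s 1\<close>, and a nonnegative matrix preserves this order.\<close>

lemma coord_sum_mult_vec_le:
  assumes "column_allowable B" "\<And>i. 0 \<le> u $ i"
  shows "coord_sum (B *v u) \<le> entry_sum B * coord_sum u"
proof -
  have "coord_sum (B *v u) \<le> coord_sum (B *v (coord_sum u *s 1))"
    by (intro coord_sum_mono mult_vec_mono assms) (simp add: component_le_coord_sum assms)
  then show ?thesis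
    by (simp add: entry_sum_eq_coord_sum vector_scalar_commute coord_sum_scale mult.commute)
qed

lemma entry_sum_mult_le:
  assumes "column_allowable B" "column_allowable B'"
  shows "entry_sum (B ** B') \<le> entry_sum B * entry_sum B'"
  using coord_sum_mult_vec_le[OF assms(1), of "B' *v 1"] mult_vec_nonneg[OF assms(2), of 1]
  by (simp add: entry_sum_eq_coord_sum matrix_vector_mul_assoc)

text \<open>The total of \<open>B *v u\<close> weights \<open>u $ j\<close> by the sum of column
  \<open>j\<close>, so the least column sum serves as \<open>c\<close>.\<close>

lemma coord_sum_mult_vec_ge:
  assumes "column_allowable B"
  obtains c where "0 < c" "\<And>u. (\<And>i. 0 \<le> u $ i) \<Longrightarrow> c * coord_sum u \<le> coord_sum (B *v u)"
proof
  define c where "c = (MIN j. \<Sum>i\<in>UNIV. B $ i $ j)"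
  show "0 < c" unfolding c_def using assms by (simp add: column_sum_pos)
  have c_le: "c \<le> (\<Sum>i\<in>UNIV. B $ i $ j)" for j
    unfolding c_def by (rule Min_le) auto
  show "c * coord_sum u \<le> coord_sum (B *v u)" if "\<And>i. 0 \<le> u $ i" for u
    unfolding coord_sum_mult_vec coord_sum_def[of u] sum_distrib_left
    by (intro sum_mono mult_right_mono c_le that)
qed

lemma coord_sum_mult_vec_pos:
  assumes "column_allowable B" "\<And>i. 0 \<le> u $ i" "0 < coord_sum u"
  shows "0 < coord_sum (B *v u)"
proof -
  obtain c where "0 < c" "c * coord_sum u \<le> coord_sum (B *v u)"
    using coord_sum_mult_vec_ge[OF assms(1)] assms(2) by metis
  then show ?thesis using assms(3) by (smt (verit) mult_pos_pos)
qed

section \<open>Words and expectations over them\<close>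

lemma finite_words: "finite (words m k)"
  unfolding words_def by (rule finite_lists_length_eq) simp

lemma word_prod_append: "word_prod A (u @ w) = word_prod A w ** word_prod A u"
proof -
  \<comment> \<open>When the fold reaches \<open>w\<close> its accumulator is already
    \<open>word_prod A u\<close>, so the fact is proved for every starting matrix.\<close>
  have "fold (\<lambda>l B. A l ** B) w B = fold (\<lambda>l B. A l ** B) w (mat 1) ** B" for w B
  proof (induction w rule: rev_induct)
    case (snoc l w)
    show ?case
      by (simp add: snoc[symmetric] flip: matrix_mul_assoc)
  qed simp
  then show ?thesis by (simp add: word_prod_def)
qed

lemma bij_betw_words_append:
  "bij_betw (\<lambda>(u, w). u @ w) (words m k \<times> words m l) (words m (k + l))"
proof (rule bij_betw_byWitness[where f' = "\<lambda>w. (take k w, drop k w)"])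
  show "(\<lambda>w. (take k w, drop k w)) ` words m (k + l) \<subseteq> words m k \<times> words m l"
    by (auto simp: words_def dest: in_set_takeD in_set_dropD)
next
  show "(\<lambda>(u, w). u @ w) ` (words m k \<times> words m l) \<subseteq> words m (k + l)"
    unfolding words_def by (auto simp del: atLeastAtMost_iff)
qed (auto simp: words_def simp del: atLeastAtMost_iff)

lemma sum_words_add:
  "(\<Sum>w\<in>words m (k + l). f w) = (\<Sum>u\<in>words m k. \<Sum>w\<in>words m l. f (u @ w))"
  by (simp add: sum.reindex_bij_betw[OF bij_betw_words_append, symmetric]
      sum.cartesian_product case_prod_unfold)

text \<open>Independence of the letters: weights of concatenated words multiply, and the later block
  acts on the left. This allows conditioning on the first \<open>k\<close> letters.\<close>

lemma expectation_add:
  "prod_expectation m A p (k + l) g =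
     prod_expectation m A p k (\<lambda>B. prod_expectation m A p l (\<lambda>B'. g (B' ** B)))"
  by (simp add: prod_expectation_def sum_words_add word_prod_append sum_distrib_left mult.assoc)

lemma words_0: "words m 0 = {[]}"
  by (auto simp: words_def)

lemma words_1: "words m 1 = (\<lambda>l. [l]) ` {1..m}"
  by (auto simp: words_def length_Suc_conv)

lemma sum_word_weights:
  "(\<Sum>w\<in>words m k. prod_list (map p w)) = (\<Sum>l=1..m. p l :: real) ^ k"
proof (induction k)
  case (Suc k)
  have "(\<Sum>w\<in>words m (1 + k). prod_list (map p w)) =
      (\<Sum>u\<in>words m 1. prod_list (map p u)) * (\<Sum>w\<in>words m k. prod_list (map p w))"
    unfolding sum_words_add by (simp add: sum_product)
  moreover have "(\<Sum>u\<in>words m 1. prod_list (map p u)) = (\<Sum>l=1..m. p l)"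
    unfolding words_1 by (simp add: sum.reindex inj_on_def)
  ultimately show ?case using Suc by simp
qed (simp add: words_0)

section \<open>The random product and its expected loss of growth\<close>

locale random_product =
  fixes m :: nat and A :: "nat \<Rightarrow> real^'n^'n" and p :: "nat \<Rightarrow> real"
  assumes p_pos: "\<And>l. l \<in> {1..m} \<Longrightarrow> p l > 0"
    and p_sum: "(\<Sum>l=1..m. p l) = 1"
    and allowable: "\<And>l. l \<in> {1..m} \<Longrightarrow> column_allowable (A l)"
begin

abbreviation E :: "nat \<Rightarrow> (real^'n^'n \<Rightarrow> real) \<Rightarrow> real" where
  "E \<equiv> prod_expectation m A p"

lemma weight_pos: "w \<in> words m k \<Longrightarrow> 0 < prod_list (map p w)"
  by (induction w arbitrary: k) (auto simp: words_def p_pos)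

lemma weight_sum: "(\<Sum>w\<in>words m k. prod_list (map p w)) = 1"
  using p_sum by (simp only: sum_word_weights power_one)

lemma word_prod_allowable: "w \<in> words m k \<Longrightarrow> column_allowable (word_prod A w)"
proof (induction w arbitrary: k rule: rev_induct)
  case Nil
  show ?case by (simp add: word_prod_def column_allowable_mat_1)
next
  case (snoc l w)
  then have "column_allowable (A l)" "column_allowable (word_prod A w)"
    by (auto simp: words_def intro!: allowable)
  moreover have "word_prod A (w @ [l]) = A l ** word_prod A w"
    by (simp add: word_prod_def)
  ultimately show ?case by (simp add: column_allowable_mult)
qed

lemma E_mono:
  assumes "\<And>B. column_allowable B \<Longrightarrow> f B \<le> g B"
  shows "E k f \<le> E k g"
  unfolding prod_expectation_def
  by (intro sum_mono mult_left_mono) (use assms word_prod_allowable weight_pos in \<open>auto intro: less_imp_le\<close>)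

lemma E_const: "E k (\<lambda>_. c) = c"
  by (simp add: prod_expectation_def weight_sum flip: sum_distrib_right)

lemma E_add: "E k (\<lambda>B. f B + g B) = E k f + E k g"
  by (simp add: prod_expectation_def sum.distrib distrib_left)

lemma E_diff: "E k (\<lambda>B. f B - g B) = E k f - E k g"
  by (simp add: prod_expectation_def sum_subtractf right_diff_distrib)

lemma E_scale: "E k (\<lambda>B. c * f B) = c * E k f"
  by (simp add: prod_expectation_def sum_distrib_left mult.left_commute)

lemma E_sum: "E k (\<lambda>B. \<Sum>i\<in>I. f i B) = (\<Sum>i\<in>I. E k (f i))"
  unfolding prod_expectation_def sum_distrib_left by (rule sum.swap)

text \<open>Turns a factor \<open>c\<close> that is uniform over the products into an additive
  constant independent of \<open>k\<close>. Positivity of \<open>f B\<close> forces that of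
  \<open>g B\<close>, so both logarithms have positive arguments.\<close>

lemma E_ln_mult:
  assumes "0 < c" "\<And>B. column_allowable B \<Longrightarrow> 0 < f B \<and> f B \<le> c * g B"
  shows "E k (\<lambda>B. ln (f B)) \<le> ln c + E k (\<lambda>B. ln (g B))"
proof -
  have "E k (\<lambda>B. ln (f B)) \<le> E k (\<lambda>B. ln c + ln (g B))"
  proof (rule E_mono)
    fix B :: "real^'n^'n" assume "column_allowable B"
    then have fg: "0 < f B" "f B \<le> c * g B" using assms(2) by auto
    then have "0 < c * g B" by linarith
    then have "0 < g B" using assms(1) by (simp add: zero_less_mult_iff)
    with fg assms(1) show "ln (f B) \<le> ln c + ln (g B)"
      by (metis ln_mono ln_mult_pos)
  qed
  then show ?thesis by (simp add: E_add E_const)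
qed

text \<open>Conditioning on the first block of \<open>r\<close> letters: if it is the positive word, the loss is
  bounded; otherwise the loss is at most the loss for the remaining letters plus a constant. The
  bound is therefore a fixed point of a contraction with ratio \<open>1 - q\<close>.\<close>

lemma growth_loss_bounded:
  assumes w0: "w0 \<in> words m r" "r \<ge> 1" "\<And>i j. word_prod A w0 $ i $ j > 0"
  obtains T where "\<And>k u. (\<And>i. 0 \<le> u $ i) \<Longrightarrow> 0 < coord_sum u \<Longrightarrow>
      E k (\<lambda>B. ln (entry_sum B * coord_sum u / coord_sum (B *v u))) \<le> T"
proof -
  define loss :: "real^'n^'n \<Rightarrow> real^'n \<Rightarrow> real"
    where "loss B u = ln (entry_sum B * coord_sum u / coord_sum (B *v u))" for B u
  \<comment> \<open>For one fixed word the loss is bounded uniformly in \<open>u\<close>: the ratio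
    of the totals before and after applying the product is at most \<open>1 / c\<close>.\<close>
  have "\<exists>K. \<forall>u. (\<forall>i. 0 \<le> u $ i) \<longrightarrow> 0 < coord_sum u \<longrightarrow> loss (word_prod A w) u \<le> K"
    if w: "w \<in> words m k" for w k
  proof -
    let ?W = "word_prod A w"
    have W: "column_allowable ?W" using word_prod_allowable w by blast
    obtain c where c: "0 < c" "\<And>u. (\<And>i. 0 \<le> u $ i) \<Longrightarrow> c * coord_sum u \<le> coord_sum (?W *v u)"
      using coord_sum_mult_vec_ge[OF W] by metis
    have "loss ?W u \<le> ln (entry_sum ?W / c)" if u: "\<forall>i. 0 \<le> u $ i" "0 < coord_sum u" for u
    proof -
      have cu: "c * coord_sum u \<le> coord_sum (?W *v u)" using c u by blast
      have pos: "0 < coord_sum (?W *v u)" using coord_sum_mult_vec_pos[OF W] u by blast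
      have "entry_sum ?W * coord_sum u / coord_sum (?W *v u) \<le> entry_sum ?W / c"
        using mult_left_mono[OF cu, of "entry_sum ?W"] pos c entry_sum_pos[OF W]
        by (simp add: field_simps)
      then show ?thesis
        unfolding loss_def using pos u(2) entry_sum_pos[OF W] by (intro ln_mono) auto
    qed
    then show ?thesis by blast
  qed
  then have "\<forall>w\<in>(\<Union>k\<le>r. words m k). \<exists>K. \<forall>u. (\<forall>i. 0 \<le> u $ i) \<longrightarrow> 0 < coord_sum u \<longrightarrow> loss (word_prod A w) u \<le> K"
    by blast
  then obtain K0 where K0: "\<And>w k u. \<lbrakk>k \<le> r; w \<in> words m k; \<And>i. 0 \<le> u $ i; 0 < coord_sum u\<rbrakk>
      \<Longrightarrow> loss (word_prod A w) u \<le> K0 w"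
    unfolding bchoice_iff by fastforce
  \<comment> \<open>A common bound for all words of length at most \<open>r\<close>: length
    \<open>r\<close> is needed for the first block, smaller lengths for the base of the
    induction.\<close>
  define K where "K = (\<Sum>w\<in>(\<Union>k\<le>r. words m k). \<bar>K0 w\<bar>)"
  have K: "loss (word_prod A w) u \<le> K" if "k \<le> r" "w \<in> words m k" "\<And>i. 0 \<le> u $ i" "0 < coord_sum u" for w k u
  proof -
    have "\<bar>K0 w\<bar> \<le> K" unfolding K_def
      by (rule member_le_sum) (use that finite_words in auto)
    then show ?thesis using K0[OF that] by linarith
  qed
  have "K \<ge> 0" by (simp add: K_def sum_nonneg)

  let ?W0 = "word_prod A w0"
  have W0: "column_allowable ?W0" using word_prod_allowable w0 by blast
  \<comment> \<open>With \<open>c\<close> the least entry of the positive product, every coordinate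
    of \<open>?W0 *v u\<close> is at least \<open>c * coord_sum u\<close>, whatever the direction of
    \<open>u\<close>.\<close>
  define c where "c = (MIN i. MIN j. ?W0 $ i $ j)"
  have c_le: "c \<le> ?W0 $ i $ j" for i j
    unfolding c_def
    by (rule order.trans[OF Min_le[of _ "MIN j. ?W0 $ i $ j"]]) (auto intro: Min_le)
  have c_pos: "0 < c" unfolding c_def using w0(3) by (simp add: Min_gr_iff)
  define K' where "K' = ln (entry_sum ?W0 / c)"
  define q where "q = prod_list (map p w0)"
  have q: "0 < q" "q \<le> 1"
  proof -
    show "0 < q" unfolding q_def using weight_pos w0(1) by blast
    have "q \<le> (\<Sum>w\<in>words m r. prod_list (map p w))" unfolding q_def
      by (rule member_le_sum) (use w0(1) weight_pos finite_words in \<open>auto intro: less_imp_le\<close>)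
    then show "q \<le> 1" by (simp add: weight_sum)
  qed
  \<comment> \<open>Chosen so that \<open>(1 - q) * (T + K) + q * K' \<le> T\<close>, which closes
    the induction step; since \<open>q \<le> 1\<close>, also \<open>K \<le> T\<close>, which covers
    the base.\<close>
  define T where "T = K / q + \<bar>K'\<bar>"
  have T_ge: "K \<le> T"
  proof -
    have "K \<le> K / q" using q \<open>K \<ge> 0\<close> by (simp add: field_simps mult_left_le)
    then show ?thesis by (simp add: T_def)
  qed

  have "E k (\<lambda>B. loss B u) \<le> T" if "\<And>i. 0 \<le> u $ i" "0 < coord_sum u" for k u
    using that
  \<comment> \<open>A step removes \<open>r\<close> letters at once, hence strong induction; the
    remaining product acts on \<open>?W *v u\<close>, hence \<open>u\<close> varies.\<close>
  proof (induction k arbitrary: u rule: less_induct)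
    case (less k)
    show ?case
    proof (cases "k < r")
      case True
      have "E k (\<lambda>B. loss B u) \<le> E k (\<lambda>_. K)"
        unfolding prod_expectation_def
        by (intro sum_mono mult_left_mono K) (use True less.prems weight_pos in \<open>auto intro: less_imp_le\<close>)
      then show ?thesis using T_ge by (simp add: E_const)
    next
      case False
      define l where "l = k - r"
      have k: "k = r + l" "l < k" using False w0(2) by (auto simp: l_def)
      \<comment> \<open>The entry sum is submultiplicative, while the ratio of totals factors
        exactly through the intermediate vector \<open>W *v u\<close>.\<close>
      have split: "loss (B ** W) u \<le> loss B (W *v u) + loss W u"
        if B: "column_allowable B" and W: "column_allowable W" for B W
      proof -
        have pos: "0 < coord_sum (W *v u)" "0 < coord_sum (B *v (W *v u))"
          using coord_sum_mult_vec_pos[OF W] coord_sum_mult_vec_pos[OF B] mult_vec_nonneg[OF W] less.prems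
          by metis+
        have "entry_sum (B ** W) * coord_sum u / coord_sum ((B ** W) *v u)
            \<le> (entry_sum B * entry_sum W) * coord_sum u / coord_sum ((B ** W) *v u)"
          using entry_sum_mult_le[OF B W] less.prems(2) pos
          by (intro divide_right_mono mult_right_mono) (auto simp: matrix_vector_mul_assoc)
        also have "\<dots> = (entry_sum B * coord_sum (W *v u) / coord_sum (B *v (W *v u)))
            * (entry_sum W * coord_sum u / coord_sum (W *v u))"
          using pos by (simp add: matrix_vector_mul_assoc)
        finally have le: "entry_sum (B ** W) * coord_sum u / coord_sum ((B ** W) *v u) \<le> \<dots>" .
        have "loss (B ** W) u \<le> ln ((entry_sum B * coord_sum (W *v u) / coord_sum (B *v (W *v u)))
            * (entry_sum W * coord_sum u / coord_sum (W *v u)))"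
          unfolding loss_def
          by (rule ln_mono[OF le])
            (use pos less.prems entry_sum_pos[OF column_allowable_mult[OF B W]] in
              \<open>auto simp: matrix_vector_mul_assoc\<close>)
        then show ?thesis
          unfolding loss_def
          using pos less.prems entry_sum_pos[OF B] entry_sum_pos[OF W]
          by (subst (asm) ln_mult_pos) auto
      qed
      \<comment> \<open>The lower bound \<open>low\<close> contains both \<open>entry_sum B\<close>
        and \<open>coord_sum u\<close>, so both cancel and the bound \<open>K'\<close> depends on
        neither \<open>B\<close> nor \<open>u\<close>.\<close>
      have pos_block: "loss (B ** ?W0) u \<le> K'" if B: "column_allowable B" for B
      proof -
        have "((c * coord_sum u) *s 1) $ i \<le> (?W0 *v u) $ i" for i
          unfolding matrix_vector_mult_def coord_sum_def
          using c_le less.prems by (auto simp: sum_distrib_left intro!: sum_mono mult_right_mono)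
        then have "coord_sum (B *v ((c * coord_sum u) *s 1)) \<le> coord_sum (B *v (?W0 *v u))"
          by (intro coord_sum_mono mult_vec_mono[OF B]) auto
        then have low: "c * coord_sum u * entry_sum B \<le> coord_sum (B *v (?W0 *v u))"
          by (simp add: entry_sum_eq_coord_sum vector_scalar_commute coord_sum_scale)
        have pos: "0 < c * coord_sum u * entry_sum B"
          using c_pos less.prems entry_sum_pos[OF B] by simp
        have "entry_sum (B ** ?W0) * coord_sum u / coord_sum ((B ** ?W0) *v u)
            \<le> (entry_sum B * entry_sum ?W0) * coord_sum u / (c * coord_sum u * entry_sum B)"
          using entry_sum_mult_le[OF B W0] less.prems(2) pos low
            entry_sum_pos[OF B] entry_sum_pos[OF W0]
          by (intro frac_le mult_right_mono) (auto simp: matrix_vector_mul_assoc)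
        also have "\<dots> = entry_sum ?W0 / c"
          using less.prems(2) entry_sum_pos[OF B] by simp
        finally show ?thesis
          unfolding loss_def K'_def
          using entry_sum_pos[OF column_allowable_mult[OF B W0]] less.prems(2) pos low
          by (intro ln_mono) (auto simp: matrix_vector_mul_assoc)
      qed
      \<comment> \<open>The two cases are merged into a constant plus a correction at
        \<open>w0\<close>, so that the weighted sum over words can be evaluated.\<close>
      have block: "E l (\<lambda>B. loss (B ** word_prod A w) u) \<le> T + K + (if w = w0 then K' - T - K else 0)"
        if w: "w \<in> words m r" for w
      proof (cases "w = w0")
        case True
        have "E l (\<lambda>B. loss (B ** ?W0) u) \<le> E l (\<lambda>_. K')"
          by (rule E_mono) (rule pos_block)
        then show ?thesis using True by (simp add: E_const)
      next
        case False
        let ?W = "word_prod A w"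
        have W: "column_allowable ?W" using word_prod_allowable w by blast
        have "E l (\<lambda>B. loss (B ** ?W) u) \<le> E l (\<lambda>B. loss B (?W *v u) + loss ?W u)"
          by (rule E_mono) (rule split[OF _ W])
        also have "\<dots> = E l (\<lambda>B. loss B (?W *v u)) + loss ?W u"
          by (simp add: E_add E_const)
        also have "E l (\<lambda>B. loss B (?W *v u)) \<le> T"
          by (rule less.IH) (use k mult_vec_nonneg[OF W] coord_sum_mult_vec_pos[OF W] less.prems in auto)
        also have "loss ?W u \<le> K" using K[OF order.refl w] less.prems by blast
        finally show ?thesis using False by simp
      qed
      have "E k (\<lambda>B. loss B u) = (\<Sum>w\<in>words m r. prod_list (map p w) * E l (\<lambda>B. loss (B ** word_prod A w) u))"
        unfolding k(1) expectation_add by (subst prod_expectation_def) simp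
      also have "\<dots> \<le> (\<Sum>w\<in>words m r. prod_list (map p w) * (T + K + (if w = w0 then K' - T - K else 0)))"
        by (intro sum_mono mult_left_mono block) (use weight_pos in \<open>auto intro: less_imp_le\<close>)
      also have "\<dots> = (T + K) + q * (K' - T - K)"
      proof -
        have "(\<Sum>w\<in>words m r. prod_list (map p w) * (if w = w0 then K' - T - K else 0))
            = (\<Sum>w\<in>words m r. if w = w0 then q * (K' - T - K) else 0)"
          by (intro sum.cong) (auto simp: q_def)
        also have "\<dots> = q * (K' - T - K)"
          using w0(1) finite_words by simp
        finally show ?thesis
          by (simp add: distrib_left[of _ "T + K"] sum.distrib weight_sum flip: sum_distrib_right)
      qed
      also have "\<dots> \<le> T"
      proof -
        have "q * T = K + q * \<bar>K'\<bar>" using q by (simp add: T_def distrib_left)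
        moreover have "q * K' \<le> q * \<bar>K'\<bar>" "0 \<le> q * K" using q \<open>K \<ge> 0\<close> by auto
        ultimately show ?thesis by (simp add: right_diff_distrib)
      qed
      finally show ?thesis .
    qed
  qed
  then show thesis using that unfolding loss_def by blast
qed

end

section \<open>Growth ratios and weighted column sums of a single matrix\<close>

lemma column_inner: "v \<bullet> column j B = (\<Sum>i\<in>UNIV. v $ i * B $ i $ j)"
  by (simp add: inner_vec_def column_def)

lemma entry_sum_le_onorm:
  fixes B :: "real^'n^'n"
  shows "entry_sum B \<le> (real CARD('n))\<^sup>2 * onorm ((*v) B)"
proof -
  have "entry_sum B \<le> (\<Sum>i\<in>(UNIV::'n set). \<Sum>j\<in>(UNIV::'n set). onorm ((*v) B))"
    unfolding entry_sum_def by (intro sum_mono order.trans[OF abs_ge_self matrix_component_le_onorm])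
  then show ?thesis by (simp add: power2_eq_square)
qed

lemma onorm_le_entry_sum:
  assumes "column_allowable B"
  shows "onorm ((*v) B) \<le> entry_sum B"
  using onorm_le_matrix_component_sum[of B] assms
  by (simp add: entry_sum_def column_allowable_nonneg)

text \<open>For nonnegative \<open>B\<close> and positive \<open>x\<close>, this is the operator
  norm of \<open>B\<close> induced by the weighted maximum norm whose weights are the reciprocals of
  the \<open>x $ i\<close>.\<close>

definition max_ratio :: "real^'n \<Rightarrow> real^'n^'n \<Rightarrow> real" where
  "max_ratio x B = (MAX i. (B *v x) $ i / x $ i)"

lemma mult_vec_le_max_ratio:
  assumes "\<And>i. 0 < x $ i"
  shows "(B *v x) $ i \<le> max_ratio x B * x $ i"
proof -
  have "(B *v x) $ i / x $ i \<le> max_ratio x B"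
    unfolding max_ratio_def by (rule Max_ge) auto
  then show ?thesis using assms[of i] by (simp add: pos_divide_le_eq)
qed

lemma max_ratio_le_iff:
  assumes "\<And>i. 0 < x $ i"
  shows "max_ratio x B \<le> c \<longleftrightarrow> (\<forall>i. (B *v x) $ i \<le> c * x $ i)"
  unfolding max_ratio_def using assms by (auto simp: pos_divide_le_eq)

lemma coord_sum_pos: "(\<And>i. 0 < x $ i) \<Longrightarrow> 0 < coord_sum x"
  unfolding coord_sum_def by (rule sum_pos) auto

lemma coord_sum_mult_vec_le_max_ratio:
  assumes "\<And>i. 0 < x $ i"
  shows "coord_sum (B *v x) \<le> max_ratio x B * coord_sum x"
  using coord_sum_mono[of "B *v x" "max_ratio x B *s x"] mult_vec_le_max_ratio[OF assms]
  by (simp add: coord_sum_scale)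

lemma max_ratio_pos:
  assumes "column_allowable B" "\<And>i. 0 < x $ i"
  shows "0 < max_ratio x B"
proof -
  have "0 < coord_sum (B *v x)"
    using assms coord_sum_pos by (intro coord_sum_mult_vec_pos) (auto intro: less_imp_le)
  then have "0 < max_ratio x B * coord_sum x"
    using coord_sum_mult_vec_le_max_ratio[OF assms(2)] by (rule less_le_trans)
  then show ?thesis using coord_sum_pos[OF assms(2)] by (simp add: zero_less_mult_iff)
qed

text \<open>Entrywise, \<open>B *v x\<close> is at most \<open>max_ratio x B *s x\<close>; applying
  the monotone map \<open>B'\<close> and bounding once more multiplies the two ratios.\<close>

lemma max_ratio_mult:
  assumes "column_allowable B" "column_allowable B'" "\<And>i. 0 < x $ i"
  shows "max_ratio x (B' ** B) \<le> max_ratio x B * max_ratio x B'"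
  unfolding max_ratio_le_iff[OF assms(3)]
proof
  fix i
  have "(B' *v (B *v x)) $ i \<le> (B' *v (max_ratio x B *s x)) $ i"
    by (rule mult_vec_mono[OF assms(2)]) (simp add: mult_vec_le_max_ratio assms(3))
  also have "\<dots> = max_ratio x B * (B' *v x) $ i"
    by (simp add: vector_scalar_commute)
  also have "\<dots> \<le> max_ratio x B * (max_ratio x B' * x $ i)"
    by (intro mult_left_mono mult_vec_le_max_ratio less_imp_le max_ratio_pos assms)
  finally show "((B' ** B) *v x) $ i \<le> max_ratio x B * max_ratio x B' * x $ i"
    by (simp add: matrix_vector_mul_assoc)
qed

text \<open>Both quantities are compared with \<open>coord_sum (B *v x)\<close>. The total of
  \<open>x\<close> divided by its least entry serves as \<open>c\<close> in both directions.\<close>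

lemma max_ratio_entry_sum_bounds:
  fixes x :: "real^'n"
  assumes x: "\<And>i. 0 < x $ i"
  obtains c where "0 < c"
    and "\<And>B. column_allowable B \<Longrightarrow> max_ratio x B \<le> c * entry_sum B"
    and "\<And>B. column_allowable B \<Longrightarrow> entry_sum B \<le> c * max_ratio x B"
proof
  define d where "d = (MIN i. x $ i)"
  have d: "0 < d" unfolding d_def using x by simp
  have d_le: "d \<le> x $ i" for i unfolding d_def by (rule Min_le) auto
  define c where "c = coord_sum x / d"
  show "0 < c" unfolding c_def using coord_sum_pos[OF x] d by simp
  fix B :: "real^'n^'n" assume B: "column_allowable B"
  show "max_ratio x B \<le> c * entry_sum B"
    unfolding max_ratio_le_iff[OF x]
  proof
    fix i
    have "(B *v x) $ i \<le> coord_sum (B *v x)"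
      by (intro component_le_coord_sum mult_vec_nonneg[OF B] less_imp_le x)
    also have "\<dots> \<le> entry_sum B * coord_sum x"
      by (intro coord_sum_mult_vec_le[OF B] less_imp_le x)
    also have "\<dots> = c * entry_sum B * d" using d by (simp add: c_def)
    also have "\<dots> \<le> c * entry_sum B * x $ i"
      by (intro mult_left_mono d_le) (use \<open>0 < c\<close> entry_sum_pos[OF B] in auto)
    finally show "(B *v x) $ i \<le> c * entry_sum B * x $ i" .
  qed
  have "d * entry_sum B = coord_sum (B *v (d *s 1))"
    by (simp add: entry_sum_eq_coord_sum vector_scalar_commute coord_sum_scale)
  also have "\<dots> \<le> coord_sum (B *v x)"
    by (intro coord_sum_mono mult_vec_mono[OF B]) (simp add: d_le)
  also have "\<dots> \<le> max_ratio x B * coord_sum x"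
    by (rule coord_sum_mult_vec_le_max_ratio[OF x])
  finally show "entry_sum B \<le> c * max_ratio x B"
    using d by (simp add: c_def field_simps)
qed

lemma column_inner_pos:
  assumes "column_allowable B" "\<And>i. 0 < v $ i"
  shows "0 < v \<bullet> column j B"
proof -
  obtain i where "0 < B $ i $ j" using assms(1) unfolding column_allowable_def by blast
  then show ?thesis unfolding column_inner
    by (intro sum_pos2[of _ i]) (use assms in \<open>auto simp: column_allowable_nonneg less_imp_le\<close>)
qed

lemma column_sum_le_inner:
  fixes v :: "real^'n"
  assumes v: "\<And>i. 0 < v $ i"
  obtains c where "0 < c"
    and "\<And>B j. column_allowable B \<Longrightarrow> (\<Sum>i\<in>UNIV. B $ i $ j) \<le> c * (v \<bullet> column j B)"
proof
  define d where "d = (MIN i. v $ i)"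
  have d: "0 < d" unfolding d_def using v by simp
  have d_le: "d \<le> v $ i" for i unfolding d_def by (rule Min_le) auto
  show "0 < 1 / d" using d by simp
  fix B :: "real^'n^'n" and j assume B: "column_allowable B"
  have "d * (\<Sum>i\<in>UNIV. B $ i $ j) \<le> v \<bullet> column j B"
    unfolding column_inner sum_distrib_left
    by (intro sum_mono mult_right_mono d_le column_allowable_nonneg[OF B])
  then show "(\<Sum>i\<in>UNIV. B $ i $ j) \<le> 1 / d * (v \<bullet> column j B)"
    using d by (simp add: field_simps)
qed

lemma column_inner_le_entry_sum:
  assumes B: "column_allowable B" and v: "\<And>i. 0 < v $ i"
  shows "v \<bullet> column j B \<le> coord_sum v * entry_sum B"
proof -
  have "v \<bullet> column j B \<le> (\<Sum>i\<in>UNIV. coord_sum v * B $ i $ j)"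
    unfolding column_inner
    by (intro sum_mono mult_right_mono component_le_coord_sum column_allowable_nonneg[OF B] less_imp_le v)
  also have "\<dots> = coord_sum v * (\<Sum>i\<in>UNIV. B $ i $ j)" by (simp add: sum_distrib_left)
  also have "(\<Sum>i\<in>UNIV. B $ i $ j) \<le> entry_sum B"
    unfolding entry_sum_def
    by (intro sum_mono member_le_sum column_allowable_nonneg[OF B]) auto
  then have "coord_sum v * (\<Sum>i\<in>UNIV. B $ i $ j) \<le> coord_sum v * entry_sum B"
    using coord_sum_pos[OF v] by simp
  finally show ?thesis .
qed

text \<open>Jensen's inequality. Divided by \<open>v \<bullet> column j B\<close>, the inner product
  for \<open>B' ** B\<close> is an average of the ratios
  \<open>(v \<bullet> column i B') / v $ i\<close>; the weights sum to 1 and depend on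
  \<open>B\<close> only.\<close>

lemma ln_column_inner_mult_ge:
  assumes B: "column_allowable B" and B': "column_allowable B'" and v: "\<And>i. 0 < v $ i"
  shows "ln (v \<bullet> column j B) + (\<Sum>i\<in>UNIV. v $ i * B $ i $ j / (v \<bullet> column j B) *
           (- ln (v $ i) + ln (v \<bullet> column i B')))
         \<le> ln (v \<bullet> column j (B' ** B))"
proof -
  define s where "s = v \<bullet> column j B"
  define y where "y i = (v \<bullet> column i B') / v $ i" for i
  define a where "a i = v $ i * B $ i $ j / s" for i
  have s: "0 < s" unfolding s_def by (rule column_inner_pos[OF B v])
  have y: "0 < y i" for i unfolding y_def using column_inner_pos[OF B' v] v by simp
  have a: "0 \<le> a i" for i
    unfolding a_def using s v column_allowable_nonneg[OF B] by (simp add: less_imp_le)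
  have a_sum: "(\<Sum>i\<in>UNIV. a i) = 1"
    using s unfolding a_def by (simp add: s_def column_inner flip: sum_divide_distrib)
  have "v \<bullet> column j (B' ** B) = (\<Sum>l\<in>UNIV. (\<Sum>i\<in>UNIV. v $ i * B' $ i $ l) * B $ l $ j)"
    unfolding column_inner matrix_matrix_mult_def
    by (simp add: sum_distrib_left sum_distrib_right mult.assoc) (rule sum.swap)
  also have "\<dots> = (\<Sum>i\<in>UNIV. s * (a i * y i))"
  proof (rule sum.cong)
    fix i
    show "(\<Sum>l\<in>UNIV. v $ l * B' $ l $ i) * B $ i $ j = s * (a i * y i)"
      using s v[of i] by (simp add: a_def y_def column_inner)
  qed simp
  finally have eq: "v \<bullet> column j (B' ** B) = s * (\<Sum>i\<in>UNIV. a i * y i)"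
    by (simp add: sum_distrib_left)
  have "0 < s * (\<Sum>i\<in>UNIV. a i * y i)"
    unfolding eq[symmetric] by (rule column_inner_pos[OF column_allowable_mult[OF B' B] v])
  then have pos: "0 < (\<Sum>i\<in>UNIV. a i * y i)" using s by (simp add: zero_less_mult_iff)
  have "(\<Sum>i\<in>UNIV. a i * ln (y i)) \<le> ln (\<Sum>i\<in>UNIV. a i *\<^sub>R y i)"
    by (rule concave_on_sum[OF _ _ ln_concave a_sum]) (use a y in auto)
  then have "ln s + (\<Sum>i\<in>UNIV. a i * ln (y i)) \<le> ln (v \<bullet> column j (B' ** B))"
    unfolding eq using s pos by (simp add: ln_mult_pos)
  moreover have "ln (y i) = - ln (v $ i) + ln (v \<bullet> column i B')" for i
    unfolding y_def using column_inner_pos[OF B' v] v by (simp add: ln_divide_pos)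
  ultimately show ?thesis by (simp add: a_def s_def)
qed

section \<open>Sub- and superadditivity, and comparison with the entry sum\<close>

context random_product
begin

text \<open>This is \<open>k * lyap_beta m A p k v\<close>, the superadditive quantity before
  normalization.\<close>

definition min_column_growth :: "real^'n \<Rightarrow> nat \<Rightarrow> real" where
  "min_column_growth v k = (MIN j. - ln (v $ j) + E k (\<lambda>B. ln (v \<bullet> column j B)))"

lemma E_ln_max_ratio_subadditive:
  assumes x: "\<And>i. 0 < x $ i"
  shows "E (k + l) (\<lambda>B. ln (max_ratio x B)) \<le> E k (\<lambda>B. ln (max_ratio x B)) + E l (\<lambda>B. ln (max_ratio x B))"
proof -
  have "E (k + l) (\<lambda>B. ln (max_ratio x B)) = E k (\<lambda>B. E l (\<lambda>B'. ln (max_ratio x (B' ** B))))"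
    by (rule expectation_add)
  also have "\<dots> \<le> E k (\<lambda>B. ln (max_ratio x B) + E l (\<lambda>B'. ln (max_ratio x B')))"
  proof (rule E_mono)
    fix B :: "real^'n^'n" assume B: "column_allowable B"
    show "E l (\<lambda>B'. ln (max_ratio x (B' ** B))) \<le> ln (max_ratio x B) + E l (\<lambda>B'. ln (max_ratio x B'))"
      by (rule E_ln_mult) (use B x in \<open>auto intro: max_ratio_pos max_ratio_mult column_allowable_mult\<close>)
  qed
  finally show ?thesis by (simp add: E_add E_const)
qed

lemma min_column_growth_le:
  "min_column_growth v k \<le> - ln (v $ j) + E k (\<lambda>B. ln (v \<bullet> column j B))"
  unfolding min_column_growth_def by (rule Min_le) auto

lemma le_min_column_growth:
  assumes "\<And>j. c \<le> - ln (v $ j) + E k (\<lambda>B. ln (v \<bullet> column j B))"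
  shows "c \<le> min_column_growth v k"
  unfolding min_column_growth_def using assms by simp

text \<open>Given the first product \<open>B\<close>, Jensen bounds the conditional expectation
  below by a convex combination over columns, and such a combination is at least the
  minimum.\<close>

lemma min_column_growth_superadditive:
  assumes v: "\<And>i. 0 < v $ i"
  shows "min_column_growth v k + min_column_growth v l \<le> min_column_growth v (k + l)"
proof (rule le_min_column_growth)
  fix j
  have "E k (\<lambda>B. ln (v \<bullet> column j B) + min_column_growth v l)
      \<le> E k (\<lambda>B. E l (\<lambda>B'. ln (v \<bullet> column j (B' ** B))))"
  proof (rule E_mono)
    fix B :: "real^'n^'n" assume B: "column_allowable B"
    define a where "a i = v $ i * B $ i $ j / (v \<bullet> column j B)" for i
    have s: "0 < v \<bullet> column j B" by (rule column_inner_pos[OF B v])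
    have a: "0 \<le> a i" for i
      unfolding a_def using s v column_allowable_nonneg[OF B] by (simp add: less_imp_le)
    have "(\<Sum>i\<in>UNIV. a i) = 1"
      using s unfolding a_def by (simp add: column_inner flip: sum_divide_distrib)
    then have "ln (v \<bullet> column j B) + min_column_growth v l
        = ln (v \<bullet> column j B) + (\<Sum>i\<in>UNIV. a i * min_column_growth v l)"
      by (simp flip: sum_distrib_right)
    also have "\<dots> \<le> ln (v \<bullet> column j B)
        + (\<Sum>i\<in>UNIV. a i * (- ln (v $ i) + E l (\<lambda>B'. ln (v \<bullet> column i B'))))"
      by (intro add_left_mono sum_mono mult_left_mono min_column_growth_le a)
    \<comment> \<open>The weights are fixed once \<open>B\<close> is, so linearity moves the convex
      combination inside the inner expectation.\<close>
    also have "\<dots> = E l (\<lambda>B'. ln (v \<bullet> column j B)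
        + (\<Sum>i\<in>UNIV. a i * (- ln (v $ i) + ln (v \<bullet> column i B'))))"
      by (simp only: E_add E_const E_sum E_scale)
    also have "\<dots> \<le> E l (\<lambda>B'. ln (v \<bullet> column j (B' ** B)))"
      unfolding a_def by (rule E_mono) (rule ln_column_inner_mult_ge[OF B _ v])
    finally show "ln (v \<bullet> column j B) + min_column_growth v l
        \<le> E l (\<lambda>B'. ln (v \<bullet> column j (B' ** B)))" .
  qed
  then have "E k (\<lambda>B. ln (v \<bullet> column j B)) + min_column_growth v l
      \<le> E (k + l) (\<lambda>B. ln (v \<bullet> column j B))"
    by (simp add: E_add E_const expectation_add)
  then show "min_column_growth v k + min_column_growth v l
      \<le> - ln (v $ j) + E (k + l) (\<lambda>B. ln (v \<bullet> column j B))"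
    using min_column_growth_le[of v k j] by linarith
qed

lemma min_column_growth_upper:
  assumes v: "\<And>i. 0 < v $ i"
  obtains C where "\<And>k. min_column_growth v k \<le> E k (\<lambda>B. ln (entry_sum B)) + C"
proof
  fix k
  \<comment> \<open>Any one column bounds the minimum from above, so the constant may depend on
    \<open>j\<close> but not on \<open>k\<close>.\<close>
  fix j :: 'n
  have "min_column_growth v k \<le> - ln (v $ j) + E k (\<lambda>B. ln (v \<bullet> column j B))"
    by (rule min_column_growth_le)
  also have "E k (\<lambda>B. ln (v \<bullet> column j B)) \<le> ln (coord_sum v) + E k (\<lambda>B. ln (entry_sum B))"
    by (rule E_ln_mult)
      (use v in \<open>auto intro: coord_sum_pos column_inner_pos column_inner_le_entry_sum\<close>)
  finally show "min_column_growth v k \<le> E k (\<lambda>B. ln (entry_sum B)) + (ln (coord_sum v) - ln (v $ j))"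
    by simp
qed

text \<open>The direction that rests on the positive word: the bounded expected loss, taken at a
  basis vector, says that every single column grows like the whole matrix.\<close>

lemma min_column_growth_lower:
  assumes v: "\<And>i. 0 < v $ i"
    and w0: "w0 \<in> words m r" "r \<ge> 1" "\<And>i j. word_prod A w0 $ i $ j > 0"
  obtains C where "\<And>k. E k (\<lambda>B. ln (entry_sum B)) \<le> min_column_growth v k + C"
proof -
  obtain T where T: "\<And>k u. (\<And>i. 0 \<le> u $ i) \<Longrightarrow> 0 < coord_sum u \<Longrightarrow>
      E k (\<lambda>B. ln (entry_sum B * coord_sum u / coord_sum (B *v u))) \<le> T"
    using growth_loss_bounded[OF w0] by blast
  obtain c where c: "0 < c"
    "\<And>B j. column_allowable B \<Longrightarrow> (\<Sum>i\<in>UNIV. B $ i $ j) \<le> c * (v \<bullet> column j B)"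
    using column_sum_le_inner[OF v] by metis
  have "E k (\<lambda>B. ln (entry_sum B)) - (T + ln c + ln (coord_sum v)) \<le> min_column_growth v k" for k
  proof (rule le_min_column_growth)
    fix j
    have axis: "coord_sum (axis j 1 :: real^'n) = 1"
      by (simp add: coord_sum_def axis_def)
    have col: "coord_sum (B *v axis j 1) = (\<Sum>i\<in>UNIV. B $ i $ j)" for B :: "real^'n^'n"
      by (simp add: matrix_vector_mult_basis coord_sum_def column_def)
    have "E k (\<lambda>B. ln (entry_sum B) - ln (\<Sum>i\<in>UNIV. B $ i $ j))
        \<le> E k (\<lambda>B. ln (entry_sum B * coord_sum (axis j 1 :: real^'n) / coord_sum (B *v axis j 1)))"
      by (rule E_mono) (simp add: axis col ln_divide_pos entry_sum_pos column_sum_pos)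
    also have "\<dots> \<le> T" by (rule T) (simp_all add: axis, simp add: axis_def)
    finally have "E k (\<lambda>B. ln (entry_sum B)) \<le> T + E k (\<lambda>B. ln (\<Sum>i\<in>UNIV. B $ i $ j))"
      by (simp add: E_diff)
    also have "E k (\<lambda>B. ln (\<Sum>i\<in>UNIV. B $ i $ j)) \<le> ln c + E k (\<lambda>B. ln (v \<bullet> column j B))"
      by (rule E_ln_mult) (use c column_sum_pos in auto)
    finally have "E k (\<lambda>B. ln (entry_sum B)) \<le> T + (ln c + E k (\<lambda>B. ln (v \<bullet> column j B)))"
      by simp
    moreover have "ln (v $ j) \<le> ln (coord_sum v)"
      using v by (intro ln_mono component_le_coord_sum) (auto intro: less_imp_le)
    ultimately show "E k (\<lambda>B. ln (entry_sum B)) - (T + ln c + ln (coord_sum v))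
        \<le> - ln (v $ j) + E k (\<lambda>B. ln (v \<bullet> column j B))"
      by linarith
  qed
  then show thesis using that[of "T + ln c + ln (coord_sum v)"] by (simp add: diff_le_eq)
qed

text \<open>Equivalence of norms, linking the entry sum to the norm used in
  \<open>lyapunov_exponent\<close>; the discrepancy does not grow with \<open>k\<close>.\<close>

lemma E_ln_onorm_bounds:
  "E k (\<lambda>B. ln (onorm ((*v) B))) \<le> E k (\<lambda>B. ln (entry_sum B))"
  "E k (\<lambda>B. ln (entry_sum B)) \<le> ln ((real CARD('n))\<^sup>2) + E k (\<lambda>B. ln (onorm ((*v) B)))"
proof -
  have pos: "0 < onorm ((*v) B)" if "column_allowable B" for B :: "real^'n^'n"
  proof -
    have "0 < (real CARD('n))\<^sup>2 * onorm ((*v) B)"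
      using entry_sum_pos[OF that] entry_sum_le_onorm by (rule less_le_trans)
    then show ?thesis by (simp add: zero_less_mult_iff)
  qed
  show "E k (\<lambda>B. ln (onorm ((*v) B))) \<le> E k (\<lambda>B. ln (entry_sum B))"
    by (intro E_mono ln_mono onorm_le_entry_sum pos)
  show "E k (\<lambda>B. ln (entry_sum B)) \<le> ln ((real CARD('n))\<^sup>2) + E k (\<lambda>B. ln (onorm ((*v) B)))"
    by (rule E_ln_mult) (auto simp: entry_sum_pos entry_sum_le_onorm)
qed

lemma E_ln_max_ratio_bounds:
  assumes x: "\<And>i. 0 < x $ i"
  obtains C where "\<And>k. E k (\<lambda>B. ln (max_ratio x B)) \<le> E k (\<lambda>B. ln (entry_sum B)) + C"
    and "\<And>k. E k (\<lambda>B. ln (entry_sum B)) \<le> E k (\<lambda>B. ln (max_ratio x B)) + C"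
proof -
  obtain c where c: "0 < c"
    "\<And>B. column_allowable B \<Longrightarrow> max_ratio x B \<le> c * entry_sum B"
    "\<And>B. column_allowable B \<Longrightarrow> entry_sum B \<le> c * max_ratio x B"
    using max_ratio_entry_sum_bounds[OF x] by metis
  have "E k (\<lambda>B. ln (max_ratio x B)) \<le> ln c + E k (\<lambda>B. ln (entry_sum B))" for k
    by (rule E_ln_mult) (use c max_ratio_pos x in auto)
  moreover have "E k (\<lambda>B. ln (entry_sum B)) \<le> ln c + E k (\<lambda>B. ln (max_ratio x B))" for k
    by (rule E_ln_mult) (use c entry_sum_pos in auto)
  ultimately show thesis using that[of "ln c"] by (simp add: add.commute)
qed

end

section \<open>The Lyapunov exponent as the common limit of both bounds\<close>

theorem theorem2:
  fixes m :: nat and A :: "nat \<Rightarrow> real^'n^'n" and p :: "nat \<Rightarrow> real" and x v :: "real^'n"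
  assumes p_pos: "\<And>l. l \<in> {1..m} \<Longrightarrow> p l > 0"
    and p_sum: "(\<Sum>l=1..m. p l) = 1"
    and nonneg: "\<And>l i j. l \<in> {1..m} \<Longrightarrow> A l $ i $ j \<ge> 0"
    and pos_prod: "\<exists>k\<ge>1. \<exists>w\<in>words m k. \<forall>i j. word_prod A w $ i $ j > 0"
    and no_zero_row: "\<And>l i. l \<in> {1..m} \<Longrightarrow> row i (A l) \<noteq> 0"
    and no_zero_column: "\<And>l j. l \<in> {1..m} \<Longrightarrow> column j (A l) \<noteq> 0"
    and x_pos: "\<And>i. x $ i > 0"
    and v_pos: "\<And>i. v $ i > 0"
  shows "(\<forall>k\<ge>1. lyap_beta m A p k v \<le> lyapunov_exponent m A p \<and>
                lyapunov_exponent m A p \<le> lyap_alpha m A p k x) \<and>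
         (\<exists>C. \<forall>k\<ge>1. lyap_alpha m A p k x - lyap_beta m A p k v \<le> C / real k)"
proof -
  interpret random_product m A p
  proof
    fix l assume l: "l \<in> {1..m}"
    have "\<exists>i. 0 < A l $ i $ j" for j
    proof (rule ccontr)
      assume "\<nexists>i. 0 < A l $ i $ j"
      then have "A l $ i $ j = 0" for i using nonneg[OF l, of i j] by (simp add: not_less antisym)
      then have "column j (A l) = 0" by (simp add: column_def vec_eq_iff)
      then show False using no_zero_column[OF l] by blast
    qed
    then show "column_allowable (A l)" using nonneg[OF l] by (simp add: column_allowable_def)
  qed (use p_pos p_sum in auto)
  define a where "a k = E k (\<lambda>B. ln (max_ratio x B))" for k
  define b where "b k = min_column_growth v k" for k
  define e where "e k = E k (\<lambda>B. ln (entry_sum B))" for k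
  define n where "n k = E k (\<lambda>B. ln (onorm ((*v) B)))" for k
  have alpha: "lyap_alpha m A p k x = a k / real k" for k
    by (simp add: lyap_alpha_def a_def max_ratio_def)
  have beta: "lyap_beta m A p k v = b k / real k" for k
    by (simp add: lyap_beta_def b_def min_column_growth_def)
  obtain w0 r where w0: "w0 \<in> words m r" "r \<ge> 1" "\<And>i j. word_prod A w0 $ i $ j > 0"
    using pos_prod by blast
  obtain C1 where C1: "\<And>k. a k \<le> e k + C1" "\<And>k. e k \<le> a k + C1"
    unfolding a_def e_def by (rule E_ln_max_ratio_bounds[where x = x]) (use x_pos in auto)
  obtain C2 where C2: "\<And>k. b k \<le> e k + C2"
    unfolding b_def e_def by (rule min_column_growth_upper[where v = v]) (use v_pos in auto)
  obtain C3 where C3: "\<And>k. e k \<le> b k + C3"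
    unfolding b_def e_def using min_column_growth_lower[of v, OF v_pos w0] by metis
  have C4: "n k \<le> e k" "e k \<le> ln ((real CARD('n))\<^sup>2) + n k" for k
    unfolding n_def e_def by (rule E_ln_onorm_bounds)+
  \<comment> \<open>Both go through \<open>e\<close>. The constant in \<open>ab\<close> is the one
    that finally appears in the \<open>1 / k\<close> estimate.\<close>
  have ab: "a k \<le> b k + (C1 + C3)" and ba: "b k \<le> a k + (C1 + C2)" for k
    using C1[of k] C2[of k] C3[of k] by linarith+
  obtain L where L: "(\<lambda>k. a k / real k) \<longlonglongrightarrow> L"
    "\<And>k. k \<ge> 1 \<Longrightarrow> b k / real k \<le> L" "\<And>k. k \<ge> 1 \<Longrightarrow> L \<le> a k / real k"
  proof (rule subadditive_superadditive_limit[of a b])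
    show "a (k + l) \<le> a k + a l" for k l
      unfolding a_def by (rule E_ln_max_ratio_subadditive[OF x_pos])
    show "b k + b l \<le> b (k + l)" for k l
      unfolding b_def by (rule min_column_growth_superadditive[OF v_pos])
  qed (rule ba ab that; assumption)+
  \<comment> \<open>From \<open>C1\<close> and \<open>C4\<close>, \<open>n k - a k\<close> is at
    most \<open>C1\<close> and \<open>a k - n k\<close> is at most \<open>C1\<close> plus the
    logarithm; the absolute value covers a negative \<open>C1\<close>.\<close>
  define D where "D = \<bar>C1\<bar> + ln ((real CARD('n))\<^sup>2)"
  have "(\<lambda>k. (n k - a k) / real k) \<longlonglongrightarrow> 0"
  proof (rule Lim_null_comparison)
    have "0 \<le> ln ((real CARD('n))\<^sup>2)" by (rule ln_ge_zero) (simp add: one_le_power)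
    then have "\<bar>n k - a k\<bar> \<le> D" for k
      unfolding D_def using C1[of k] C4[of k] by linarith
    then show "\<forall>\<^sub>F k in sequentially. norm ((n k - a k) / real k) \<le> D / real k"
      by (simp add: divide_right_mono)
  qed (rule lim_const_over_n)
  from tendsto_add[OF L(1) this] have "(\<lambda>k. n k / real k) \<longlonglongrightarrow> L"
    by (simp flip: add_divide_distrib)
  \<comment> \<open>\<open>lim\<close> is a definite description, so its value is known only once
    convergence to \<open>L\<close> has been shown.\<close>
  then have lyap: "lyapunov_exponent m A p = L"
    unfolding lyapunov_exponent_def n_def by (intro limI) simp
  have "a k / real k - b k / real k \<le> (C1 + C3) / real k" for k
    using ab[of k] by (simp add: divide_right_mono flip: diff_divide_distrib)
  then show ?thesis
    using L unfolding alpha beta lyap by blast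
qed

end
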